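(* Let $n > t \ge 0$ be integers. Suppose $a_1,\dots,a_m,b_1,\dots,b_m \in \{0,1\}^n$ satisfy, for all $i \in [m]$, $\mathrm{dist}(a_i,b_i) = t + s_i$ for some integer $s_i \ge 1$, and $\mathrm{dist}(a_i,b_j) + \mathrm{dist}(a_j,b_i) \le 2t$ for all distinct $i,j \in [m]$. Then $$\sum_{i=1}^m \frac{V_{t+s_i,s_i}}{2^{t+s_i}} \le 1.$$ In particular, $f'(t;\{0,1\}) \le 2^{t+1}$, and if $s \ge 1$ is such that $s_i \ge s$ for all $i \in [m]$, then $m \le 2^{t+s}/V_{t+s,s}$; consequently $f'(t,s;\{0,1\}) \le 2^{t+s}/V_{t+s,s}$.
   Context: For $p,q \in \{0,1\}^n$, $\mathrm{dist}(p,q)$ is the Hamming distance (number of coordinates in which they differ). For integers $1 \le d \le n$, $V_{n,d} = \sum_{i=0}^{(d-1)/2} \binom{n}{i}$ if $d$ is odd, and $V_{n,d} = \sum_{i=0}^{d/2-1} \binom{n}{i} + \binom{n-1}{d/2-1}$ if $d$ is even. For a set $X$, $f'(t;X)$ is the maximum $m$ such that there exist $n > t$ and $a_1,\dots,a_m,b_1,\dots,b_m \in X^n$ with $\mathrm{dist}(a_i,b_i) \ge t+1$ for all $i$ and $\mathrm{dist}(a_i,b_j)+\mathrm{dist}(a_j,b_i) \le 2t$ for all distinct $i,j$. For $s \ge 1$, $f'(t,s;X)$ is defined the same way but with $\mathrm{dist}(a_i,b_i) \ge t+s$ in place of $\mathrm{dist}(a_i,b_i) \ge t+1$. *)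

theory Defs
  imports Complex_Main "HOL-Library.FuncSet" "HOL-Library.Extended_Real"
begin

definition cube :: "'a set \<Rightarrow> nat \<Rightarrow> (nat \<Rightarrow> 'a) set" where
  "cube X n = PiE {..<n} (\<lambda>_. X)"

definition hdist :: "nat \<Rightarrow> (nat \<Rightarrow> 'a) \<Rightarrow> (nat \<Rightarrow> 'a) \<Rightarrow> nat" where
  "hdist n p q = card {k \<in> {..<n}. p k \<noteq> q k}"

text \<open>Only meaningful for \<open>1 \<le> d \<le> n\<close>, where no natural subtraction below is truncated.\<close>

definition V :: "nat \<Rightarrow> nat \<Rightarrow> nat" where
  "V n d = (if odd d then (\<Sum>i = 0..(d - 1) div 2. n choose i)
            else (\<Sum>i = 0..d div 2 - 1. n choose i) + ((n - 1) choose (d div 2 - 1)))"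

text \<open>Some \<open>m\<close> pairs in \<open>X ^ n\<close>, for some \<open>n > t\<close>, with diagonal distances at least \<open>r\<close>.\<close>

definition admissible :: "nat \<Rightarrow> nat \<Rightarrow> 'a set \<Rightarrow> nat \<Rightarrow> bool" where
  "admissible t r X m \<longleftrightarrow>
     (\<exists>n a b. n > t \<and>
        (\<forall>i\<in>{1..m}. a i \<in> cube X n \<and> b i \<in> cube X n) \<and>
        (\<forall>i\<in>{1..m}. hdist n (a i) (b i) \<ge> r) \<and>
        (\<forall>i\<in>{1..m}. \<forall>j\<in>{1..m}. i \<noteq> j \<longrightarrow>
           hdist n (a i) (b j) + hdist n (a j) (b i) \<le> 2 * t))"

text \<open>The maxima are taken as suprema in \<^typ>\<open>enat\<close>, so that they have the value \<open>\<infinity>\<close>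
  rather than an arbitrary one when the admissible \<open>m\<close> are unbounded; whenever the
  supremum is finite it is attained (lemmas \<open>fprime_max\<close> and \<open>fprime_s_max\<close> below).\<close>

definition fprime :: "nat \<Rightarrow> 'a set \<Rightarrow> enat" where
  "fprime t X = Sup (enat ` {m. admissible t (t + 1) X m})"

definition fprime_s :: "nat \<Rightarrow> nat \<Rightarrow> 'a set \<Rightarrow> enat" where
  "fprime_s t s X = Sup (enat ` {m. admissible t (t + s) X m})"

lemma admissible_0: "admissible t r X 0"
  unfolding admissible_def by auto

lemma Sup_enat_attained:
  assumes "P 0" and "Sup (enat ` {m. P m}) = enat k"
  shows "P k \<and> (\<forall>m. P m \<longrightarrow> m \<le> k)"
proof -
  have le: "m \<le> k" if "P m" for m
    using Sup_upper[of "enat m" "enat ` {m. P m}"] that assms(2) by auto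
  have fin: "finite {m. P m}"
    using le by (meson finite_nat_set_iff_bounded_le mem_Collect_eq)
  have "Sup (enat ` {m. P m}) = Max (enat ` {m. P m})"
    using fin assms(1) by (intro Max_Sup[symmetric]) auto
  moreover have "Max (enat ` {m. P m}) \<in> enat ` {m. P m}"
    using fin assms(1) by (intro Max_in) auto
  ultimately show ?thesis using assms(2) le by auto
qed

lemma fprime_max:
  assumes "fprime t X = enat k"
  shows "admissible t (t + 1) X k \<and> (\<forall>m. admissible t (t + 1) X m \<longrightarrow> m \<le> k)"
  using Sup_enat_attained[of "admissible t (t + 1) X" k] admissible_0 assms
  unfolding fprime_def by blast

lemma fprime_s_max:
  assumes "fprime_s t s X = enat k"
  shows "admissible t (t + s) X k \<and> (\<forall>m. admissible t (t + s) X m \<longrightarrow> m \<le> k)"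
  using Sup_enat_attained[of "admissible t (t + s) X" k] admissible_0 assms
  unfolding fprime_s_def by blast

end

theory Submission
  imports Defs
begin

text \<open>Identify points of \<open>{0,1}\<^sup>n\<close> with sets. Let \<open>D\<^sub>i\<close> be the set of coordinates in which
  \<open>a\<^sub>i\<close> and \<open>b\<^sub>i\<close> differ, and for a point \<open>p\<close> let \<open>Q\<^sub>i\<close> be the set of coordinates in \<open>D\<^sub>i\<close> in which
  \<open>p\<close> and \<open>b\<^sub>i\<close> differ. The event \<open>E\<^sub>i\<close> consists of the \<open>p\<close> with \<open>2|Q\<^sub>i| < s\<^sub>i\<close>, or \<open>2|Q\<^sub>i| = s\<^sub>i\<close> and
  \<open>min D\<^sub>i \<in> Q\<^sub>i\<close>; it has density \<open>V\<^bsub>t+s\<^sub>i,s\<^sub>i\<^esub> / 2\<^bsup>t+s\<^sub>i\<^esup>\<close>. The events are disjoint: since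
  \<open>dist(p,a\<^sub>i) - dist(p,b\<^sub>i) = t + s\<^sub>i - 2|Q\<^sub>i| \<ge> t\<close>, a common point of \<open>E\<^sub>i\<close> and \<open>E\<^sub>j\<close> forces equality
  in the triangle inequalities for \<open>p,b\<^sub>j,a\<^sub>i\<close> and \<open>p,b\<^sub>i,a\<^sub>j\<close>, whence \<open>Q\<^sub>i \<subseteq> D\<^sub>j - Q\<^sub>j\<close> and
  \<open>Q\<^sub>j \<subseteq> D\<^sub>i - Q\<^sub>i\<close>, so that \<open>min D\<^sub>i = min D\<^sub>j\<close> would lie both in \<open>Q\<^sub>j\<close> and outside it.\<close>

section \<open>Distances as symmetric differences\<close>

lemma card_sym_diff:
  assumes "finite X" "finite Y"
  shows "card (sym_diff X Y) + 2 * card (X \<inter> Y) = card X + card Y"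
proof -
  have "card (sym_diff X Y) = card (X - Y) + card (Y - X)"
    using assms by (intro card_Un_disjoint) auto
  moreover have "card X = card (X - Y) + card (X \<inter> Y)"
    by (metis assms(1) card_Int_Diff add.commute)
  moreover have "card Y = card (Y - X) + card (X \<inter> Y)"
    by (metis assms(2) card_Int_Diff add.commute Int_commute)
  ultimately show ?thesis by simp
qed

text \<open>Exact form of the triangle inequality: the detour from \<open>P\<close> to
  \<open>A\<close> through \<open>B\<close> wastes two moves on each coordinate flipped in both
  legs.\<close>

lemma card_sym_diff_via:
  assumes "finite P" "finite A" "finite B"
  shows "card (sym_diff P A) + 2 * card (sym_diff P B \<inter> sym_diff A B)
    = card (sym_diff P B) + card (sym_diff A B)"
proof -
  have "sym_diff P A = sym_diff (sym_diff P B) (sym_diff A B)" by auto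
  then show ?thesis
    using card_sym_diff[of "sym_diff P B" "sym_diff A B"] assms by simp
qed

section \<open>The families \<open>low\<close> and their sizes\<close>

text \<open>For odd \<open>s\<close> a Hamming ball around the empty set. For even \<open>s\<close>,
  a ball of radius \<open>s div 2 - 1\<close> in the coordinates other than \<open>Min D\<close>,
  with \<open>Min D\<close> left free.\<close>

definition low :: "nat set \<Rightarrow> nat \<Rightarrow> nat set set" where
  "low D s = {Q. Q \<subseteq> D \<and> (2 * card Q < s \<or> 2 * card Q = s \<and> Min D \<in> Q)}"

lemma card_subsets_card_le:
  assumes "finite D"
  shows "card {Q. Q \<subseteq> D \<and> card Q \<le> r} = (\<Sum>i = 0..r. card D choose i)"
proof -
  have eq: "{Q. Q \<subseteq> D \<and> card Q \<le> r} = (\<Union>i\<in>{0..r}. {Q. Q \<subseteq> D \<and> card Q = i})"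
    by auto
  have "card \<dots> = (\<Sum>i = 0..r. card {Q. Q \<subseteq> D \<and> card Q = i})"
    using assms by (intro card_UN_disjoint) auto
  then show ?thesis using eq n_subsets[OF assms] by simp
qed

lemma card_subsets_card_mem:
  assumes "finite D" "d \<in> D" "0 < r"
  shows "card {Q. Q \<subseteq> D \<and> card Q = r \<and> d \<in> Q} = (card D - 1) choose (r - 1)"
proof -
  have "bij_betw (insert d) {Q. Q \<subseteq> D - {d} \<and> card Q = r - 1} {Q. Q \<subseteq> D \<and> card Q = r \<and> d \<in> Q}"
  proof (rule bij_betwI[where g = "\<lambda>Q. Q - {d}"])
    show "insert d \<in> {Q. Q \<subseteq> D - {d} \<and> card Q = r - 1} \<rightarrow> {Q. Q \<subseteq> D \<and> card Q = r \<and> d \<in> Q}"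
    proof
      fix Q assume Q: "Q \<in> {Q. Q \<subseteq> D - {d} \<and> card Q = r - 1}"
      then have "finite Q" "d \<notin> Q" using assms(1) by (auto intro: finite_subset)
      then show "insert d Q \<in> {Q. Q \<subseteq> D \<and> card Q = r \<and> d \<in> Q}"
        using Q assms by auto
    qed
    show "(\<lambda>Q. Q - {d}) \<in> {Q. Q \<subseteq> D \<and> card Q = r \<and> d \<in> Q} \<rightarrow> {Q. Q \<subseteq> D - {d} \<and> card Q = r - 1}"
      by auto
  qed auto
  then have "card {Q. Q \<subseteq> D \<and> card Q = r \<and> d \<in> Q} = card {Q. Q \<subseteq> D - {d} \<and> card Q = r - 1}"
    by (simp add: bij_betw_same_card)
  then show ?thesis using n_subsets[of "D - {d}" "r - 1"] assms by simp
qed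

lemma card_low:
  assumes "finite D" "1 \<le> s" "s \<le> card D"
  shows "card (low D s) = V (card D) s"
proof (cases "odd s")
  case True
  then have "low D s = {Q. Q \<subseteq> D \<and> card Q \<le> (s - 1) div 2}"
    unfolding low_def by (auto elim!: oddE)
  then show ?thesis using True card_subsets_card_le[OF assms(1)] by (simp add: V_def)
next
  case False
  then obtain r where r: "s = 2 * r" by (auto elim: evenE)
  with assms have r0: "0 < r" by simp
  have D: "Min D \<in> D" using assms by (intro Min_in) auto
  have "low D s = {Q. Q \<subseteq> D \<and> card Q \<le> r - 1} \<union> {Q. Q \<subseteq> D \<and> card Q = r \<and> Min D \<in> Q}"
    using r r0 unfolding low_def by auto
  then have "card (low D s) = card {Q. Q \<subseteq> D \<and> card Q \<le> r - 1}
      + card {Q. Q \<subseteq> D \<and> card Q = r \<and> Min D \<in> Q}"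
    using assms(1) r0 by (simp only:) (rule card_Un_disjoint, auto)
  then show ?thesis
    using card_subsets_card_le[OF assms(1)] card_subsets_card_mem[OF assms(1) D r0] False r
    by (simp add: V_def)
qed

section \<open>Density and disjointness of the events\<close>

text \<open>\<open>P\<close> is determined by \<open>sym_diff P B\<close>, whose part inside
  \<open>D\<close> ranges over \<open>F\<close> and whose part outside \<open>D\<close> is
  free.\<close>

lemma card_trace_in:
  assumes "finite N" "D \<subseteq> N" "B \<subseteq> N" "F \<subseteq> Pow D"
  shows "card {P \<in> Pow N. sym_diff P B \<inter> D \<in> F} = card F * 2 ^ (card N - card D)"
proof -
  have "bij_betw (\<lambda>P. (sym_diff P B \<inter> D, sym_diff P B - D))
      {P \<in> Pow N. sym_diff P B \<inter> D \<in> F} (F \<times> Pow (N - D))"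
  proof (rule bij_betwI[where g = "\<lambda>(Q, R). sym_diff (Q \<union> R) B"])
    show "(\<lambda>(Q, R). sym_diff (Q \<union> R) B)
        \<in> F \<times> Pow (N - D) \<rightarrow> {P \<in> Pow N. sym_diff P B \<inter> D \<in> F}"
    proof (clarsimp, intro conjI)
      fix Q R assume QR: "Q \<in> F" "R \<subseteq> N - D"
      then have "Q \<subseteq> D" using assms(4) by auto
      then have "sym_diff (sym_diff (Q \<union> R) B) B \<inter> D = Q"
        using QR(2) \<open>Q \<subseteq> D\<close> by blast
      then show "sym_diff (sym_diff (Q \<union> R) B) B \<inter> D \<in> F" using QR by simp
      show "Q \<union> R - B \<subseteq> N" "B - (Q \<union> R) \<subseteq> N" using QR \<open>Q \<subseteq> D\<close> assms by auto
    qed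
  qed (use assms in auto)
  then have "card {P \<in> Pow N. sym_diff P B \<inter> D \<in> F} = card (F \<times> Pow (N - D))"
    by (rule bij_betw_same_card)
  also have "\<dots> = card F * 2 ^ (card N - card D)"
    using assms by (simp add: card_cartesian_product card_Pow card_Diff_subset finite_subset)
  finally show ?thesis .
qed

lemma low_events_disjoint:
  fixes A\<^sub>1 A\<^sub>2 B\<^sub>1 B\<^sub>2 P :: "nat set"
  assumes fin: "finite A\<^sub>1" "finite A\<^sub>2" "finite B\<^sub>1" "finite B\<^sub>2" "finite P"
    and c1: "card (sym_diff A\<^sub>1 B\<^sub>1) = t + s\<^sub>1" and c2: "card (sym_diff A\<^sub>2 B\<^sub>2) = t + s\<^sub>2"
    and cross: "card (sym_diff A\<^sub>1 B\<^sub>2) + card (sym_diff A\<^sub>2 B\<^sub>1) \<le> 2 * t"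
    and low1: "sym_diff P B\<^sub>1 \<inter> sym_diff A\<^sub>1 B\<^sub>1 \<in> low (sym_diff A\<^sub>1 B\<^sub>1) s\<^sub>1"
    and low2: "sym_diff P B\<^sub>2 \<inter> sym_diff A\<^sub>2 B\<^sub>2 \<in> low (sym_diff A\<^sub>2 B\<^sub>2) s\<^sub>2"
  shows False
proof -
  define D\<^sub>1 Q\<^sub>1 D\<^sub>2 Q\<^sub>2 where "D\<^sub>1 = sym_diff A\<^sub>1 B\<^sub>1" and "Q\<^sub>1 = sym_diff P B\<^sub>1 \<inter> D\<^sub>1"
    and "D\<^sub>2 = sym_diff A\<^sub>2 B\<^sub>2" and "Q\<^sub>2 = sym_diff P B\<^sub>2 \<inter> D\<^sub>2"
  note defs = D\<^sub>1_def Q\<^sub>1_def D\<^sub>2_def Q\<^sub>2_def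
  have e: "card (sym_diff P A\<^sub>1) + 2 * card Q\<^sub>1 = card (sym_diff P B\<^sub>1) + (t + s\<^sub>1)"
    "card (sym_diff P A\<^sub>2) + 2 * card Q\<^sub>2 = card (sym_diff P B\<^sub>2) + (t + s\<^sub>2)"
    "card (sym_diff P A\<^sub>1) + 2 * card (sym_diff P B\<^sub>2 \<inter> sym_diff A\<^sub>1 B\<^sub>2)
      = card (sym_diff P B\<^sub>2) + card (sym_diff A\<^sub>1 B\<^sub>2)"
    "card (sym_diff P A\<^sub>2) + 2 * card (sym_diff P B\<^sub>1 \<inter> sym_diff A\<^sub>2 B\<^sub>1)
      = card (sym_diff P B\<^sub>1) + card (sym_diff A\<^sub>2 B\<^sub>1)"
    using card_sym_diff_via[of P A\<^sub>1 B\<^sub>1] card_sym_diff_via[of P A\<^sub>2 B\<^sub>2]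
      card_sym_diff_via[of P A\<^sub>1 B\<^sub>2] card_sym_diff_via[of P A\<^sub>2 B\<^sub>1] fin c1 c2
    unfolding defs by simp_all
  have l: "2 * card Q\<^sub>1 < s\<^sub>1 \<or> 2 * card Q\<^sub>1 = s\<^sub>1 \<and> Min D\<^sub>1 \<in> Q\<^sub>1"
    "2 * card Q\<^sub>2 < s\<^sub>2 \<or> 2 * card Q\<^sub>2 = s\<^sub>2 \<and> Min D\<^sub>2 \<in> Q\<^sub>2"
    using low1 low2 unfolding low_def defs by blast+
  \<comment> \<open>With \<open>x\<close>, \<open>y\<close> the two cardinalities and
    \<open>c\<close> the left side of \<open>cross\<close>, eliminating the distances from
    \<open>P\<close> in \<open>e\<close> gives \<open>2 * card Q\<^sub>1 + 2 * card Q\<^sub>2 =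
    s\<^sub>1 + s\<^sub>2 + (2 * t - c) + 2 * (x + y)\<close>. By \<open>l\<close> the left side is
    at most \<open>s\<^sub>1 + s\<^sub>2\<close>, so everything is tight and only the tie cases of
    \<open>l\<close> remain.\<close>
  have "card (sym_diff P B\<^sub>2 \<inter> sym_diff A\<^sub>1 B\<^sub>2) = 0" "card (sym_diff P B\<^sub>1 \<inter> sym_diff A\<^sub>2 B\<^sub>1) = 0"
    and min: "Min D\<^sub>1 \<in> Q\<^sub>1" "Min D\<^sub>2 \<in> Q\<^sub>2"
    using e l cross by linarith+
  then have "sym_diff P B\<^sub>2 \<inter> sym_diff A\<^sub>1 B\<^sub>2 = {}" "sym_diff P B\<^sub>1 \<inter> sym_diff A\<^sub>2 B\<^sub>1 = {}"
    using fin by (metis card_0_eq finite_Diff finite_Int finite_Un)+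
  \<comment> \<open>On \<open>Q\<^sub>1\<close>, \<open>P\<close> agrees with
    \<open>A\<^sub>1\<close> and not with \<open>B\<^sub>1\<close>. The first empty intersection
    makes \<open>P\<close> agree with \<open>B\<^sub>2\<close> there, the second makes
    \<open>A\<^sub>2\<close> agree with \<open>B\<^sub>1\<close>, so \<open>A\<^sub>2\<close> and
    \<open>B\<^sub>2\<close> differ.\<close>
  then have sub: "Q\<^sub>1 \<subseteq> D\<^sub>2 - Q\<^sub>2" "Q\<^sub>2 \<subseteq> D\<^sub>1 - Q\<^sub>1"
    unfolding defs by blast+
  have "finite D\<^sub>1" "finite D\<^sub>2" using fin unfolding defs by auto
  then have "Min D\<^sub>1 = Min D\<^sub>2" using min sub by (metis Diff_iff Min_le subsetD order_antisym)
  then show False using min sub by auto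
qed

lemma sum_V_le_1:
  fixes A B :: "'i \<Rightarrow> nat set"
  assumes "finite N" "finite I"
    and AB: "\<And>i. i \<in> I \<Longrightarrow> A i \<subseteq> N \<and> B i \<subseteq> N"
    and diag: "\<And>i. i \<in> I \<Longrightarrow> 1 \<le> s i \<and> card (sym_diff (A i) (B i)) = t + s i"
    and cross: "\<And>i j. \<lbrakk>i \<in> I; j \<in> I; i \<noteq> j\<rbrakk> \<Longrightarrow>
      card (sym_diff (A i) (B j)) + card (sym_diff (A j) (B i)) \<le> 2 * t"
  shows "(\<Sum>i\<in>I. real (V (t + s i) (s i)) / 2 ^ (t + s i)) \<le> 1"
proof -
  define D where "D i = sym_diff (A i) (B i)" for i
  define E where "E i = {P \<in> Pow N. sym_diff P (B i) \<inter> D i \<in> low (D i) (s i)}" for i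
  have fin: "finite (A i)" "finite (B i)" if "i \<in> I" for i
    using AB[OF that] assms(1) by (auto intro: finite_subset)
  have DN: "D i \<subseteq> N" if "i \<in> I" for i using AB[OF that] unfolding D_def by auto
  have card_E: "real (V (t + s i) (s i)) / 2 ^ (t + s i) = real (card (E i)) / 2 ^ card N"
    if i: "i \<in> I" for i
  proof -
    have cD: "card (D i) = t + s i" using diag[OF i] by (simp add: D_def)
    have "finite (D i)" using DN[OF i] assms(1) by (rule finite_subset)
    then have "card (low (D i) (s i)) = V (t + s i) (s i)"
      using card_low[of "D i" "s i"] diag[OF i] cD by simp
    moreover have "low (D i) (s i) \<subseteq> Pow (D i)" by (auto simp: low_def)
    ultimately have "card (E i) = V (t + s i) (s i) * 2 ^ (card N - (t + s i))"
      using card_trace_in[of N "D i" "B i" "low (D i) (s i)"] assms(1) DN[OF i] AB[OF i] cD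
      unfolding E_def by simp
    \<comment> \<open>This keeps the subtraction in the exponent from being truncated.\<close>
    moreover have "t + s i \<le> card N" using card_mono[OF assms(1) DN[OF i]] cD by simp
    moreover from this have "(2::real) ^ card N = 2 ^ (t + s i) * 2 ^ (card N - (t + s i))"
      by (simp flip: power_add)
    ultimately show ?thesis by simp
  qed
  have "(\<Sum>i\<in>I. card (E i)) = card (\<Union>i\<in>I. E i)"
  proof (rule card_UN_disjoint[symmetric])
    show "\<forall>i\<in>I. \<forall>j\<in>I. i \<noteq> j \<longrightarrow> E i \<inter> E j = {}"
    proof (intro ballI impI equals0I)
      fix i j P assume ij: "i \<in> I" "j \<in> I" "i \<noteq> j" and P: "P \<in> E i \<inter> E j"
      then have "finite P" using assms(1) by (auto simp: E_def intro: finite_subset)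
      then show False
        using low_events_disjoint[of "A i" "A j" "B i" "B j" P t "s i" "s j"]
          fin ij diag cross[OF ij] P unfolding E_def D_def by blast
    qed
  qed (use assms E_def in auto)
  also have "\<dots> \<le> card (Pow N)"
    using assms(1) by (intro card_mono) (auto simp: E_def)
  finally have "(\<Sum>i\<in>I. card (E i)) \<le> 2 ^ card N" using assms(1) by (simp add: card_Pow)
  then have "(\<Sum>i\<in>I. real (card (E i))) \<le> 2 ^ card N"
    by (metis of_nat_le_iff of_nat_numeral of_nat_power of_nat_sum)
  then show ?thesis using card_E by (simp add: sum_divide_distrib[symmetric])
qed

section \<open>Monotonicity of the densities\<close>

lemma double_V_le:
  assumes "1 \<le> d" "d \<le> n"
  shows "2 * V n d \<le> V (Suc n) (Suc d)"
proof -
  \<comment> \<open>Pascal's rule summed over \<open>i\<close>; the added term makes up for the top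
    coefficient being counted only once. For odd \<open>d\<close> it gives equality in the
    claim.\<close>
  have pascal: "(\<Sum>i = 0..k. Suc n choose i) + (n choose k) = 2 * (\<Sum>i = 0..k. n choose i)" for k
    by (induction k) auto
  show ?thesis
  proof (cases "odd d")
    case True
    then obtain k where "d = 2 * k + 1" by (auto elim: oddE)
    then show ?thesis using pascal[of k] by (simp add: V_def)
  next
    case False
    then obtain k where d: "d = 2 * k" by (auto elim: evenE)
    then obtain l where l: "k = Suc l" using assms by (cases k) auto
    \<comment> \<open>For even \<open>d\<close>, \<open>pascal\<close> reduces the claim to
      \<open>2 * (n - 1 choose l) \<le> n choose k\<close>, which follows from absorption and
      \<open>2 * k = d \<le> n\<close>.\<close>
    have "k * (2 * (n - 1 choose l)) \<le> n * (n - 1 choose l)"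
      using assms d by simp
    also have "\<dots> = k * (n choose k)"
      using times_binomial_minus1_eq[of k n] l by simp
    finally have "2 * (n - 1 choose l) \<le> n choose k"
      using l by (metis mult_le_cancel1 zero_less_Suc)
    then show ?thesis using pascal[of l] pascal[of k] d l by (simp add: V_def)
  qed
qed

lemma V_pos: "0 < V n d"
  unfolding V_def by (simp add: sum.atLeast_Suc_atMost)

text \<open>Each increment of \<open>s\<close> doubles the denominator and at least doubles
  \<open>V\<close>. This lets a common lower bound replace the individual excesses.\<close>

lemma V_density_mono:
  assumes "1 \<le> s" "s \<le> s'"
  shows "real (V (t + s) s) / 2 ^ (t + s) \<le> real (V (t + s') s') / 2 ^ (t + s')"
  using assms(2)
proof (induction s' rule: dec_induct)
  case (step r)
  have "2 * V (t + r) r \<le> V (t + Suc r) (Suc r)"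
    using double_V_le[of r "t + r"] step.hyps assms(1) by simp
  then have "2 * real (V (t + r) r) \<le> real (V (t + Suc r) (Suc r))"
    by (metis of_nat_le_iff of_nat_mult of_nat_numeral)
  then have "real (V (t + r) r) / 2 ^ (t + r) \<le> real (V (t + Suc r) (Suc r)) / 2 ^ (t + Suc r)"
    by (simp add: field_simps)
  with step.IH show ?case by simp
qed simp

section \<open>Binary words and the bounds on the number of pairs\<close>

lemma hdist_cube_01:
  fixes p q :: "nat \<Rightarrow> nat"
  assumes "p \<in> cube {0, 1} n" "q \<in> cube {0, 1} n"
  shows "hdist n p q = card (sym_diff {k \<in> {..<n}. p k = 1} {k \<in> {..<n}. q k = 1})"
proof -
  have "p k \<in> {0, 1}" "q k \<in> {0, 1}" if "k < n" for k
    using assms that unfolding cube_def by (auto simp: PiE_iff)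
  then have "{k \<in> {..<n}. p k \<noteq> q k} = sym_diff {k \<in> {..<n}. p k = 1} {k \<in> {..<n}. q k = 1}"
    by fastforce
  then show ?thesis unfolding hdist_def by simp
qed

lemma sum_V_cube_le_1:
  fixes a b :: "nat \<Rightarrow> nat \<Rightarrow> nat"
  assumes cube: "\<forall>i\<in>{1..m}. a i \<in> cube {0, 1} n \<and> b i \<in> cube {0, 1} n"
    and diag: "\<forall>i\<in>{1..m}. s i \<ge> 1 \<and> hdist n (a i) (b i) = t + s i"
    and cross: "\<forall>i\<in>{1..m}. \<forall>j\<in>{1..m}. i \<noteq> j \<longrightarrow>
      hdist n (a i) (b j) + hdist n (a j) (b i) \<le> 2 * t"
  shows "(\<Sum>i = 1..m. real (V (t + s i) (s i)) / 2 ^ (t + s i)) \<le> 1"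
proof (rule sum_V_le_1[where N = "{..<n}" and A = "\<lambda>i. {k \<in> {..<n}. a i k = 1}"
      and B = "\<lambda>i. {k \<in> {..<n}. b i k = 1}"])
  have h: "card (sym_diff {k \<in> {..<n}. a i k = 1} {k \<in> {..<n}. b j k = 1}) = hdist n (a i) (b j)"
    if "i \<in> {1..m}" "j \<in> {1..m}" for i j
    using hdist_cube_01[of "a i" n "b j"] cube that by simp
  show "1 \<le> s i \<and> card (sym_diff {k \<in> {..<n}. a i k = 1} {k \<in> {..<n}. b i k = 1}) = t + s i"
    if "i \<in> {1..m}" for i
    using h[OF that that] diag that by metis
  show "card (sym_diff {k \<in> {..<n}. a i k = 1} {k \<in> {..<n}. b j k = 1})
      + card (sym_diff {k \<in> {..<n}. a j k = 1} {k \<in> {..<n}. b i k = 1}) \<le> 2 * t"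
    if "i \<in> {1..m}" "j \<in> {1..m}" "i \<noteq> j" for i j
    using h[OF that(1,2)] h[OF that(2,1)] cross that by metis
qed auto

text \<open>Each of the \<open>m\<close> summands is at least the density for
  \<open>s0\<close>.\<close>

lemma card_le_of_sum_V_le_1:
  assumes "(\<Sum>i = 1..m. real (V (t + s i) (s i)) / 2 ^ (t + s i)) \<le> 1"
    and "1 \<le> s0" "\<forall>i\<in>{1..m}. s0 \<le> s i"
  shows "real m \<le> 2 ^ (t + s0) / real (V (t + s0) s0)"
proof -
  have "(\<Sum>i = 1..m. real (V (t + s0) s0) / 2 ^ (t + s0))
      \<le> (\<Sum>i = 1..m. real (V (t + s i) (s i)) / 2 ^ (t + s i))"
    using assms by (intro sum_mono V_density_mono) auto
  also note assms(1)
  finally have "real m * (real (V (t + s0) s0) / 2 ^ (t + s0)) \<le> 1" by simp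
  then show ?thesis using V_pos[of "t + s0" s0] by (simp add: pos_le_divide_eq pos_divide_le_eq)
qed

lemma admissible_bound:
  assumes "admissible t (t + s) {0, 1::nat} m" "1 \<le> s"
  shows "real m \<le> 2 ^ (t + s) / real (V (t + s) s)"
proof -
  from assms(1) obtain n a b where
    cube: "\<forall>i\<in>{1..m}. a i \<in> cube {0, 1::nat} n \<and> b i \<in> cube {0, 1} n"
    and diag: "\<forall>i\<in>{1..m}. hdist n (a i) (b i) \<ge> t + s"
    and cross: "\<forall>i\<in>{1..m}. \<forall>j\<in>{1..m}. i \<noteq> j \<longrightarrow>
      hdist n (a i) (b j) + hdist n (a j) (b i) \<le> 2 * t"
    unfolding admissible_def by blast
  \<comment> \<open>\<open>admissible\<close> only bounds the diagonal distances below;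
    \<open>\<sigma>\<close> records the exact excess over \<open>t\<close>.\<close>
  define \<sigma> where "\<sigma> i = hdist n (a i) (b i) - t" for i
  have \<sigma>: "\<forall>i\<in>{1..m}. \<sigma> i \<ge> s \<and> hdist n (a i) (b i) = t + \<sigma> i"
    using diag by (fastforce simp: \<sigma>_def)
  show ?thesis
  proof (rule card_le_of_sum_V_le_1)
    show "(\<Sum>i = 1..m. real (V (t + \<sigma> i) (\<sigma> i)) / 2 ^ (t + \<sigma> i)) \<le> 1"
      using \<sigma> assms(2) by (intro sum_V_cube_le_1[OF cube _ cross]) fastforce
  qed (use \<sigma> assms(2) in auto)
qed

theorem theorem3p1:
  fixes t :: nat
  shows
    "(\<forall>(n::nat) (m::nat) (a :: nat \<Rightarrow> nat \<Rightarrow> nat) (b :: nat \<Rightarrow> nat \<Rightarrow> nat) (s :: nat \<Rightarrow> nat).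
        n > t \<longrightarrow>
        (\<forall>i\<in>{1..m}. a i \<in> cube {0, 1} n \<and> b i \<in> cube {0, 1} n) \<longrightarrow>
        (\<forall>i\<in>{1..m}. s i \<ge> 1 \<and> hdist n (a i) (b i) = t + s i) \<longrightarrow>
        (\<forall>i\<in>{1..m}. \<forall>j\<in>{1..m}. i \<noteq> j \<longrightarrow>
           hdist n (a i) (b j) + hdist n (a j) (b i) \<le> 2 * t) \<longrightarrow>
        (\<Sum>i = 1..m. real (V (t + s i) (s i)) / 2 ^ (t + s i)) \<le> 1 \<and>
        (\<forall>s0\<ge>1. (\<forall>i\<in>{1..m}. s i \<ge> s0) \<longrightarrow>
           real m \<le> 2 ^ (t + s0) / real (V (t + s0) s0)))
     \<and> fprime t {0, 1::nat} \<le> 2 ^ (t + 1)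
     \<and> (\<forall>s\<ge>1. ereal_of_enat (fprime_s t s {0, 1::nat})
           \<le> ereal (2 ^ (t + s) / real (V (t + s) s)))"
proof (intro conjI)
  show "\<forall>(n::nat) (m::nat) (a :: nat \<Rightarrow> nat \<Rightarrow> nat) (b :: nat \<Rightarrow> nat \<Rightarrow> nat) (s :: nat \<Rightarrow> nat).
        n > t \<longrightarrow>
        (\<forall>i\<in>{1..m}. a i \<in> cube {0, 1} n \<and> b i \<in> cube {0, 1} n) \<longrightarrow>
        (\<forall>i\<in>{1..m}. s i \<ge> 1 \<and> hdist n (a i) (b i) = t + s i) \<longrightarrow>
        (\<forall>i\<in>{1..m}. \<forall>j\<in>{1..m}. i \<noteq> j \<longrightarrow>
           hdist n (a i) (b j) + hdist n (a j) (b i) \<le> 2 * t) \<longrightarrow>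
        (\<Sum>i = 1..m. real (V (t + s i) (s i)) / 2 ^ (t + s i)) \<le> 1 \<and>
        (\<forall>s0\<ge>1. (\<forall>i\<in>{1..m}. s i \<ge> s0) \<longrightarrow>
           real m \<le> 2 ^ (t + s0) / real (V (t + s0) s0))"
    using sum_V_cube_le_1 card_le_of_sum_V_le_1 by (intro allI impI conjI) blast+
  show "fprime t {0, 1::nat} \<le> 2 ^ (t + 1)"
    unfolding fprime_def
  proof (rule Sup_least, clarsimp)
    fix m assume "admissible t (Suc t) {0, Suc 0} m"
    \<comment> \<open>Here \<open>V (t + 1) 1 = 1\<close>, the single term
      \<open>i = 0\<close>.\<close>
    then have "real m \<le> 2 ^ (t + 1)"
      using admissible_bound[of t 1 m] by (simp add: V_def)
    then have "m \<le> 2 ^ (t + 1)"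
      by (metis of_nat_le_iff of_nat_numeral of_nat_power)
    then have "enat m \<le> enat (2 ^ (t + 1))" by simp
    also have "enat (2 ^ (t + 1)) = 2 ^ (t + 1)"
      by (metis of_nat_eq_enat of_nat_numeral of_nat_power)
    finally show "enat m \<le> 2 * 2 ^ t" by simp
  qed
  show "\<forall>s\<ge>1. ereal_of_enat (fprime_s t s {0, 1::nat})
      \<le> ereal (2 ^ (t + s) / real (V (t + s) s))"
  proof (intro allI impI)
    fix s :: nat assume s: "1 \<le> s"
    let ?c = "2 ^ (t + s) / real (V (t + s) s)"
    \<comment> \<open>The floor shows that the supremum is finite, hence attained; the real bound
      then applies to the maximum itself.\<close>
    have "fprime_s t s {0, 1::nat} \<le> enat (nat \<lfloor>?c\<rfloor>)"
      unfolding fprime_s_def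
      using admissible_bound[OF _ s] by (intro Sup_least) (auto simp: le_nat_floor)
    then obtain k where k: "fprime_s t s {0, 1::nat} = enat k"
      by (cases "fprime_s t s {0, 1::nat}") auto
    then have "real k \<le> ?c"
      using fprime_s_max[OF k] admissible_bound s by blast
    then show "ereal_of_enat (fprime_s t s {0, 1::nat}) \<le> ereal ?c"
      using k by simp
  qed
qed

end
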